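(* Let $\mathbf{G}\in\mathcal{R}_{sp}$ be a strictly proper plant and let $\{\hat{\mathbf{Y}},\hat{\mathbf{W}},\hat{\mathbf{U}},\hat{\mathbf{Z}}\}$ satisfy $$\begin{bmatrix} I & -\mathbf{G}\end{bmatrix}\begin{bmatrix}\hat{\mathbf{Y}}&\hat{\mathbf{W}}\\ \hat{\mathbf{U}}&\hat{\mathbf{Z}}\end{bmatrix}=\begin{bmatrix} I & O\end{bmatrix},\qquad \begin{bmatrix}\hat{\mathbf{Y}}&\hat{\mathbf{W}}\\ \hat{\mathbf{U}}&\hat{\mathbf{Z}}\end{bmatrix}\begin{bmatrix}-\mathbf{G}\\ I\end{bmatrix}=\begin{bmatrix} O\\ I\end{bmatrix},\qquad \hat{\mathbf{Y}},\hat{\mathbf{U}},\hat{\mathbf{W}},\hat{\mathbf{Z}}\in\mathcal{RH}_\infty .$$ Consider an additive perturbation $\boldsymbol{\Delta}_{\mathbf{G}}\in\mathcal{RH}_\infty$ on the plant, so that $\mathbf{G}(\boldsymbol{\Delta}_{\mathbf{G}})=\mathbf{G}+\boldsymbol{\Delta}_{\mathbf{G}}$. Then the nominal controller $$\hat{\mathbf{K}}=\hat{\mathbf{U}}\hat{\mathbf{Y}}^{-1}$$ internally stabilizes the perturbed system if and only if $$(I-\boldsymbol{\Delta}_{\mathbf{G}}\hat{\mathbf{U}})^{-1}\in\mathcal{RH}_\infty .$$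
   Context: Transfer matrices are matrices of real rational functions; $\mathcal{R}_{sp}$ and $\mathcal{RH}_\infty$ denote the sets of strictly proper and of stable proper transfer matrices, respectively (defined according to the underlying setting, continuous or discrete time). A statement that an inverse lies in $\mathcal{RH}_\infty$ includes that the inverse exists. $I$ and $O$ are identity and zero matrices. The closed-loop system with plant $\mathbf{G}(\boldsymbol{\Delta}_{\mathbf{G}})$ and proper controller $\mathbf{K}$ has internal state $\boldsymbol{\eta}$ stacking measurement $\mathbf{y}$ and control $\mathbf{u}$, and obeys $\boldsymbol{\eta}=\mathbf{R}\boldsymbol{\eta}+\mathbf{d}$ with arbitrary external disturbance $\mathbf{d}$ and $$\mathbf{R}=\begin{bmatrix} O & \mathbf{G}(\boldsymbol{\Delta}_{\mathbf{G}})\\ \mathbf{K} & O\end{bmatrix}.$$ The controller $\mathbf{K}$ internally stabilizes the perturbed system if $(I-\mathbf{R})^{-1}$ exists and lies in $\mathcal{RH}_\infty$. *)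

theory Defs
  imports
    "HOL-Analysis.Analysis"
    "HOL-Computational_Algebra.Polynomial_Factorial"
    "HOL-Computational_Algebra.Normalized_Fraction"
    "HOL-Computational_Algebra.Field_as_Ring"
begin

type_synonym rat_fun = "real poly fract"

type_synonym ('u, 'y) tf_matrix = "rat_fun ^ 'u ^ 'y"

text \<open>
  \<open>quot_of_fract\<close> returns the numerator and denominator in lowest terms, so the complex
  roots of the denominator are exactly the finite poles.
\<close>

definition poles :: "rat_fun \<Rightarrow> complex set" where
  "poles q = {s. poly (map_poly complex_of_real (snd (quot_of_fract q))) s = 0}"

definition proper :: "rat_fun \<Rightarrow> bool" where
  "proper q \<longleftrightarrow> degree (fst (quot_of_fract q)) \<le> degree (snd (quot_of_fract q))"

text \<open>The zero function is listed separately because \<open>degree 0 = 0\<close>.\<close>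

definition strictly_proper :: "rat_fun \<Rightarrow> bool" where
  "strictly_proper q \<longleftrightarrow>
     q = 0 \<or> degree (fst (quot_of_fract q)) < degree (snd (quot_of_fract q))"

datatype time_setting = Continuous | Discrete

fun stability_region :: "time_setting \<Rightarrow> complex set" where
  "stability_region Continuous = {s. Re s < 0}"
| "stability_region Discrete = {z. cmod z < 1}"

definition R_p :: "('u::finite, 'y::finite) tf_matrix set" where
  "R_p = {A. \<forall>i j. proper (A $ i $ j)}"

definition R_sp :: "('u::finite, 'y::finite) tf_matrix set" where
  "R_sp = {A. \<forall>i j. strictly_proper (A $ i $ j)}"

definition RH_inf :: "time_setting \<Rightarrow> ('u::finite, 'y::finite) tf_matrix set" where
  "RH_inf T = {A. \<forall>i j. proper (A $ i $ j) \<and> poles (A $ i $ j) \<subseteq> stability_region T}"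

definition inverse_in_RH_inf :: "time_setting \<Rightarrow> ('n::finite, 'n) tf_matrix \<Rightarrow> bool" where
  "inverse_in_RH_inf T A \<longleftrightarrow> invertible A \<and> matrix_inv A \<in> RH_inf T"

text \<open>Block matrices are indexed by sum types, with \<open>Inl\<close> addressing the first block.\<close>

definition row_blocks :: "'a ^ 'm ^ 'r \<Rightarrow> 'a ^ 'n ^ 'r \<Rightarrow> 'a ^ ('m + 'n) ^ 'r" where
  "row_blocks A B = (\<chi> i j. case j of Inl k \<Rightarrow> A $ i $ k | Inr k \<Rightarrow> B $ i $ k)"

definition col_blocks :: "'a ^ 'c ^ 'm \<Rightarrow> 'a ^ 'c ^ 'n \<Rightarrow> 'a ^ 'c ^ ('m + 'n)" where
  "col_blocks A B = (\<chi> i. case i of Inl k \<Rightarrow> A $ k | Inr k \<Rightarrow> B $ k)"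

definition four_blocks ::
  "'a ^ 'm ^ 'r \<Rightarrow> 'a ^ 'n ^ 'r \<Rightarrow> 'a ^ 'm ^ 's \<Rightarrow> 'a ^ 'n ^ 's \<Rightarrow> 'a ^ ('m + 'n) ^ ('r + 's)" where
  "four_blocks A B C D = col_blocks (row_blocks A B) (row_blocks C D)"

text \<open>
  The realization matrix \<open>R\<close> of the loop \<open>\<eta> = R \<eta> + d\<close>, with internal state \<open>\<eta>\<close>
  stacking the measurement \<open>y\<close> and the control \<open>u\<close>, for plant \<open>P\<close> and controller \<open>K\<close>.
\<close>

definition closed_loop ::
  "('u::finite, 'y::finite) tf_matrix \<Rightarrow> ('y, 'u) tf_matrix \<Rightarrow> ('y + 'u, 'y + 'u) tf_matrix" where
  "closed_loop P K = four_blocks 0 P K 0"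

text \<open>Only proper controllers are admissible.\<close>

definition internally_stabilizes ::
  "time_setting \<Rightarrow> ('y::finite, 'u::finite) tf_matrix \<Rightarrow> ('u, 'y) tf_matrix \<Rightarrow> bool" where
  "internally_stabilizes T K P \<longleftrightarrow>
     K \<in> R_p \<and> inverse_in_RH_inf T (mat 1 - closed_loop P K)"

end

theory Submission
  imports Defs
begin

text \<open>
  Write \<open>R(P)\<close> for the realization matrix with plant \<open>P\<close> and controller
  \<open>K = U Y\<^sup>-\<^sup>1\<close>, and \<open>S\<close> for the block matrix with rows \<open>Y, W\<close> and \<open>U, Z\<close>.
  The four parametrization identities say \<open>Y = I + G U\<close>, \<open>W = G Z = Y G\<close> and
  \<open>Z = I + U G\<close>, so that \<open>S\<close> is the closed-loop response of the nominal loop: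
  \<open>(I - R(G)) S = I\<close>.  Perturbing the plant changes only the upper right block of
  \<open>R\<close>, hence \<open>(I - R(G + \<Delta>)) S\<close> is block upper triangular with diagonal blocks
  \<open>I - \<Delta> U\<close> and \<open>I\<close> (\<open>perturbed_loop_mult_nominal_response\<close>).

  If \<open>I - \<Delta> U\<close> has a stable inverse, so has the triangular matrix, and multiplying that
  inverse by the stable \<open>S\<close> gives the stable inverse of \<open>I - R(G + \<Delta>)\<close>.  The converse
  cannot simply divide by \<open>S\<close>, since \<open>S\<^sup>-\<^sup>1 = I - R(G)\<close> contains the possibly unstable
  \<open>G\<close> and \<open>K\<close>.  Instead, let \<open>C\<close> be the lower left block of the stable inverse of
  \<open>I - R(G + \<Delta>)\<close>, that is, the response of the control to disturbances of the measurement.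
  The triangular form yields \<open>C (I - \<Delta> U) = U\<close>, and therefore \<open>I + \<Delta> C\<close> is an
  inverse of \<open>I - \<Delta> U\<close>; it is built from stable matrices only.

  The equivalence of the two stability conditions is thus algebra in the ring of stable proper
  functions.  Strict properness of \<open>G\<close> enters through the controller: it makes \<open>Y = I + G U\<close>
  equal to the identity at infinity, so that \<open>Y\<close> is invertible with a proper inverse and
  \<open>K\<close> is a proper transfer matrix.
\<close>

section \<open>Rational functions filtered by degree\<close>

text \<open>
  The degree of numerator minus that of denominator is, up to sign, the valuation at infinity.
  Bounding it by an arbitrary integer treats proper (bound \<open>0\<close>) and strictly proper (bound
  \<open>-1\<close>) functions together and makes the products below additive in the bound.
\<close>

definition deg_le :: "int \<Rightarrow> rat_fun \<Rightarrow> bool" where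
  "deg_le m q \<longleftrightarrow>
     q = 0 \<or> int (degree (fst (quot_of_fract q))) \<le> int (degree (snd (quot_of_fract q))) + m"

lemma proper_iff_deg_le: "proper q \<longleftrightarrow> deg_le 0 q"
  by (auto simp: proper_def deg_le_def)

lemma strictly_proper_iff_deg_le: "strictly_proper q \<longleftrightarrow> deg_le (-1) q"
  by (auto simp: strictly_proper_def deg_le_def)

lemma quot_of_fract_Fract_cross:
  fixes a b :: "real poly"
  assumes "b \<noteq> 0"
  shows "a * snd (quot_of_fract (Fract a b)) = fst (quot_of_fract (Fract a b)) * b"
proof -
  have "Fract (fst (quot_of_fract (Fract a b))) (snd (quot_of_fract (Fract a b))) = Fract a b"
    by simp
  then show ?thesis
    using assms by (subst (asm) eq_fract) (simp_all add: mult.commute)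
qed

text \<open>
  Cancelling a common factor lowers both degrees equally, so the bound can be read off from any
  representation; this is what lets sums and products be estimated without reducing them.
\<close>

lemma deg_le_Fract_iff:
  assumes "b \<noteq> 0"
  shows "deg_le m (Fract a b) \<longleftrightarrow> a = 0 \<or> int (degree a) \<le> int (degree b) + m"
proof (cases "a = 0")
  case True
  then show ?thesis by (simp add: deg_le_def fract_collapse)
next
  case False
  let ?n = "fst (quot_of_fract (Fract a b))" and ?d = "snd (quot_of_fract (Fract a b))"
  have "Fract a b \<noteq> 0"
    using assms False by (simp add: Zero_fract_def eq_fract)
  moreover from this have "?n \<noteq> 0" by simp
  ultimately have "degree a + degree ?d = degree ?n + degree b"
    using quot_of_fract_Fract_cross[OF assms, of a] False assms
    by (metis degree_mult_eq snd_quot_of_fract_nonzero)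
  with \<open>Fract a b \<noteq> 0\<close> False show ?thesis
    unfolding deg_le_def by auto
qed

lemma deg_le_ex: "\<exists>m::nat. deg_le (int m) q"
  unfolding deg_le_def by (rule exI[of _ "degree (fst (quot_of_fract q))"]) simp

lemma deg_le_mono: "deg_le m q \<Longrightarrow> m \<le> n \<Longrightarrow> deg_le n q"
  by (auto simp: deg_le_def)

lemma deg_le_0 [simp]: "deg_le m 0"
  by (simp add: deg_le_def)

lemma deg_le_all_imp_zero: 
  assumes "\<And>n::nat. deg_le (m - int n) q"
  shows "q = 0"
  using assms[of "nat (m + int (degree (snd (quot_of_fract q))) + 1)"]
    assms[of 0]
  by (auto simp: deg_le_def)

lemma deg_le_add:
  assumes "deg_le m p" "deg_le m q"
  shows "deg_le m (p + q)"
proof -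
  obtain a b c d where pq: "p = Fract a b" "b \<noteq> 0" "q = Fract c d" "d \<noteq> 0"
    by (meson Fract_cases)
  have "degree (a * d + c * b) \<le> max (degree (a * d)) (degree (c * b))"
    by (rule degree_add_le_max)
  moreover have "a = 0 \<or> int (degree (a * d)) \<le> int (degree (b * d)) + m"
    using assms pq degree_mult_le[of a d] by (auto simp: deg_le_Fract_iff degree_mult_eq)
  moreover have "c = 0 \<or> int (degree (c * b)) \<le> int (degree (b * d)) + m"
    using assms pq degree_mult_le[of c b] by (auto simp: deg_le_Fract_iff degree_mult_eq)
  moreover have "p + q = Fract (a * d + c * b) (b * d)" "b * d \<noteq> 0"
    using pq by simp_all
  ultimately show ?thesis
    by (auto simp: deg_le_Fract_iff simp del: mult_eq_0_iff)
qed

lemma deg_le_mult: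
  assumes "deg_le m p" "deg_le n q"
  shows "deg_le (m + n) (p * q)"
proof -
  obtain a b c d where pq: "p = Fract a b" "b \<noteq> 0" "q = Fract c d" "d \<noteq> 0"
    by (meson Fract_cases)
  then show ?thesis
    using assms degree_mult_le[of a c] by (auto simp: deg_le_Fract_iff degree_mult_eq)
qed

lemma deg_le_one: "deg_le 0 1"
  by (simp add: deg_le_def)

lemma deg_le_uminus: "deg_le m q \<Longrightarrow> deg_le m (- q)"
  by (auto simp: deg_le_def quot_of_fract_uminus case_prod_unfold Let_def)

lemma deg_le_sum:
  assumes "\<And>i. i \<in> I \<Longrightarrow> deg_le m (f i)"
  shows "deg_le m (sum f I)"
  using assms by (induction I rule: infinite_finite_induct) (simp_all add: deg_le_add)

lemma deg_le_matrix_vector_mult: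
  fixes A :: "rat_fun ^ 'n::finite ^ 'm::finite"
  assumes "\<And>i j. deg_le m (A $ i $ j)" "\<And>j. deg_le n (x $ j)"
  shows "deg_le (m + n) ((A *v x) $ i)"
  unfolding matrix_vector_mult_def by (simp add: deg_le_sum deg_le_mult assms)

lemma deg_le_matrix_mult:
  fixes A :: "rat_fun ^ 'n::finite ^ 'm::finite" and B :: "rat_fun ^ 'k::finite ^ 'n"
  assumes "\<And>i j. deg_le m (A $ i $ j)" "\<And>i j. deg_le n (B $ i $ j)"
  shows "deg_le (m + n) ((A ** B) $ i $ j)"
  unfolding matrix_matrix_mult_def by (simp add: deg_le_sum deg_le_mult assms)

lemma deg_le_vec_ex:
  fixes x :: "rat_fun ^ 'n::finite"
  shows "\<exists>m::nat. \<forall>i. deg_le (int m) (x $ i)"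
proof -
  obtain f :: "'n \<Rightarrow> nat" where f: "\<forall>i. deg_le (int (f i)) (x $ i)"
    using choice[of "\<lambda>i m. deg_le (int m) (x $ i)"] deg_le_ex by blast
  have "deg_le (int (Max (range f))) (x $ i)" for i
    by (rule deg_le_mono[OF f[rule_format]]) simp
  then show ?thesis by blast
qed

section \<open>Matrices equal to the identity at infinity\<close>

text \<open>
  A kernel vector of \<open>I + N\<close> satisfies \<open>x = - N x\<close>.  As \<open>N\<close> lowers the degree by one, the
  bound on \<open>x\<close> can be improved indefinitely, which forces \<open>x = 0\<close>.
\<close>

lemma mat_1_plus_strictly_proper_invertible:
  fixes N :: "rat_fun ^ 'n::finite ^ 'n"
  assumes N: "\<And>i j. deg_le (-1) (N $ i $ j)"
  shows "invertible (mat 1 + N)"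
proof -
  have "x = 0" if "(mat 1 + N) *v x = 0" for x
  proof -
    have x: "- (N *v x) = x"
      using that by (simp add: matrix_vector_mult_add_rdistrib neg_eq_iff_add_eq_0 add.commute)
    obtain m where m: "\<And>i. deg_le (int m) (x $ i)"
      using deg_le_vec_ex by blast
    have "\<forall>i. deg_le (int m - int n) (x $ i)" for n
    proof (induction n)
      case 0
      then show ?case using m by simp
    next
      case (Suc n)
      have "deg_le (-1 + (int m - int n)) ((N *v x) $ i)" for i
        using N Suc by (intro deg_le_matrix_vector_mult) auto
      then have "deg_le (-1 + (int m - int n)) ((- (N *v x)) $ i)" for i
        by (simp add: deg_le_uminus)
      then show ?case
        unfolding x by (simp add: algebra_simps)
    qed
    then have "x $ i = 0" for i
      using deg_le_all_imp_zero by blast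
    then show ?thesis by (simp add: vec_eq_iff)
  qed
  then show ?thesis
    using invertible_left_inverse matrix_left_invertible_ker by blast
qed

text \<open>
  The same descent for the inhomogeneous equation \<open>x = b - N x\<close>, which now stops at the bound
  for \<open>b\<close>.  Applied to the columns of the inverse, it shows that the inverse is proper.
\<close>

lemma proper_if_mat_1_plus_strictly_proper_mult_proper:
  fixes N :: "rat_fun ^ 'n::finite ^ 'n"
  assumes N: "\<And>i j. deg_le (-1) (N $ i $ j)"
    and b: "\<And>i. deg_le 0 (((mat 1 + N) *v x) $ i)"
  shows "deg_le 0 (x $ i)"
proof -
  let ?b = "(mat 1 + N) *v x"
  have x: "?b + - (N *v x) = x"
    by (simp add: matrix_vector_mult_add_rdistrib)
  have "\<forall>i. deg_le 0 (x $ i)" if "\<forall>i. deg_le (int m) (x $ i)" for m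
    using that
  proof (induction m)
    case (Suc m)
    have "deg_le (-1 + int (Suc m)) ((N *v x) $ i)" for i
      using N Suc.prems by (intro deg_le_matrix_vector_mult) auto
    then have "deg_le (int m) ((N *v x) $ i)" for i
      by simp
    then have "deg_le (int m) ((?b + - (N *v x)) $ i)" for i
      unfolding vector_add_component vector_uminus_component
      by (intro deg_le_add deg_le_uminus deg_le_mono[OF b]) simp_all
    then show ?case
      unfolding x using Suc.IH by blast
  qed simp
  then show ?thesis
    using deg_le_vec_ex[of x] by blast
qed

lemma matrix_inv_inverse:
  fixes A :: "'a::semiring_1 ^ 'n ^ 'm"
  assumes "invertible A"
  shows "A ** matrix_inv A = mat 1" "matrix_inv A ** A = mat 1"
  using someI_ex[OF assms[unfolded invertible_def]] by (simp_all add: matrix_inv_def)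

lemma matrix_inv_proper:
  fixes N :: "rat_fun ^ 'n::finite ^ 'n"
  assumes N: "\<And>i j. deg_le (-1) (N $ i $ j)"
  shows "matrix_inv (mat 1 + N) \<in> R_p"
proof -
  let ?B = "matrix_inv (mat 1 + N)"
  have "(mat 1 + N) *v column j ?B = axis j 1" for j
  proof -
    have "(mat 1 + N) *v column j ?B = column j ((mat 1 + N) ** ?B)"
      by (simp add: vec_eq_iff column_def matrix_vector_mult_def matrix_matrix_mult_def)
    also have "(mat 1 + N) ** ?B = mat 1"
      by (intro matrix_inv_inverse mat_1_plus_strictly_proper_invertible N)
    also have "column j (mat 1) = (axis j 1 :: rat_fun ^ 'n)"
      by (simp add: vec_eq_iff column_def mat_def axis_def)
    finally show ?thesis .
  qed
  then have "deg_le 0 (column j ?B $ i)" for i j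
    by - (rule proper_if_mat_1_plus_strictly_proper_mult_proper[OF N], simp add: axis_def deg_le_one)
  then show ?thesis
    by (simp add: R_p_def proper_iff_deg_le column_def)
qed

section \<open>Stable proper transfer matrices\<close>

lemma map_poly_complex_of_real_mult:
  "map_poly complex_of_real (p * q) = map_poly complex_of_real p * map_poly complex_of_real q"
  by (rule poly_eqI) (simp add: coeff_map_poly coeff_mult)

text \<open>
  The reduced denominator divides every other denominator, so poles may be bounded through an
  unreduced fraction, such as the one produced by adding or multiplying fractions.
\<close>

lemma poles_Fract_subset:
  assumes "b \<noteq> 0"
  shows "poles (Fract a b) \<subseteq> {s. poly (map_poly complex_of_real b) s = 0}"
proof -
  let ?q = "quot_of_fract (Fract a b)"
  have "coprime (snd ?q) (fst ?q)"
    by (simp add: coprime_commute coprime_quot_of_fract)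
  moreover have "snd ?q dvd fst ?q * b"
    by (metis quot_of_fract_Fract_cross[OF assms] dvd_triv_right)
  ultimately have "snd ?q dvd b"
    by (simp add: coprime_dvd_mult_right_iff)
  then obtain c where c: "b = snd ?q * c" ..
  show ?thesis
    unfolding poles_def by (subst (2) c) (auto simp: map_poly_complex_of_real_mult)
qed

lemma poles_Fract_mult_subset:
  "poles (Fract a (snd (quot_of_fract p) * snd (quot_of_fract q))) \<subseteq> poles p \<union> poles q"
  using poles_Fract_subset[of "snd (quot_of_fract p) * snd (quot_of_fract q)" a]
  by (auto simp: poles_def map_poly_complex_of_real_mult)

lemma poles_add: "poles (p + q) \<subseteq> poles p \<union> poles q"
proof -
  have "p + q = Fract (fst (quot_of_fract p)) (snd (quot_of_fract p)) +
      Fract (fst (quot_of_fract q)) (snd (quot_of_fract q))"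
    by simp
  also have "\<dots> = Fract (fst (quot_of_fract p) * snd (quot_of_fract q) + fst (quot_of_fract q) * snd (quot_of_fract p))
      (snd (quot_of_fract p) * snd (quot_of_fract q))"
    by (rule add_fract) simp_all
  finally show ?thesis
    using poles_Fract_mult_subset by metis
qed

lemma poles_mult: "poles (p * q) \<subseteq> poles p \<union> poles q"
proof -
  have "p * q = Fract (fst (quot_of_fract p)) (snd (quot_of_fract p)) *
      Fract (fst (quot_of_fract q)) (snd (quot_of_fract q))"
    by simp
  also have "\<dots> = Fract (fst (quot_of_fract p) * fst (quot_of_fract q))
      (snd (quot_of_fract p) * snd (quot_of_fract q))"
    by (rule mult_fract)
  finally show ?thesis
    using poles_Fract_mult_subset by metis
qed

lemma poles_0 [simp]: "poles 0 = {}" and poles_1 [simp]: "poles 1 = {}"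
  by (simp_all add: poles_def)

lemma poles_sum: "poles (sum f I) \<subseteq> (\<Union>i\<in>I. poles (f i))"
  by (induction I rule: infinite_finite_induct) (use poles_add in fastforce)+

lemma RH_inf_add: "A \<in> RH_inf T \<Longrightarrow> B \<in> RH_inf T \<Longrightarrow> A + B \<in> RH_inf T"
  using poles_add by (fastforce simp: RH_inf_def proper_iff_deg_le intro: deg_le_add)

lemma RH_inf_mult:
  fixes A :: "('n::finite, 'm::finite) tf_matrix" and B :: "('k::finite, 'n) tf_matrix"
  assumes "A \<in> RH_inf T" "B \<in> RH_inf T"
  shows "A ** B \<in> RH_inf T"
proof -
  have "proper ((A ** B) $ i $ j)" for i j
    using deg_le_matrix_mult[of 0 A 0 B] assms by (simp add: RH_inf_def proper_iff_deg_le)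
  moreover have "poles ((A ** B) $ i $ j) \<subseteq> stability_region T" for i j
  proof -
    have "poles ((A ** B) $ i $ j) \<subseteq> (\<Union>k. poles (A $ i $ k * B $ k $ j))"
      unfolding matrix_matrix_mult_def by (simp add: poles_sum)
    also have "\<dots> \<subseteq> (\<Union>k. poles (A $ i $ k) \<union> poles (B $ k $ j))"
      using poles_mult by blast
    also have "\<dots> \<subseteq> stability_region T"
      using assms by (fastforce simp: RH_inf_def)
    finally show ?thesis .
  qed
  ultimately show ?thesis by (simp add: RH_inf_def)
qed

lemma RH_inf_0: "0 \<in> RH_inf T"
  by (simp add: RH_inf_def proper_iff_deg_le)

lemma RH_inf_mat_1: "mat 1 \<in> RH_inf T"
  by (simp add: RH_inf_def proper_iff_deg_le mat_def deg_le_one)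

text \<open>
  Over a field a one-sided inverse of a square matrix is the inverse, so a stable inverse may be
  certified by one matrix product.
\<close>

lemma inverse_in_RH_inf_iff:
  "inverse_in_RH_inf T A \<longleftrightarrow> (\<exists>B \<in> RH_inf T. A ** B = mat 1)"
proof
  assume "inverse_in_RH_inf T A"
  then show "\<exists>B \<in> RH_inf T. A ** B = mat 1"
    unfolding inverse_in_RH_inf_def using matrix_inv_inverse(1) by blast
next
  assume "\<exists>B \<in> RH_inf T. A ** B = mat 1"
  then obtain B where B: "B \<in> RH_inf T" "A ** B = mat 1" by blast
  then have A: "invertible A" by (auto simp: invertible_right_inverse)
  have "matrix_inv A = matrix_inv A ** (A ** B)" by (simp add: B)
  also have "\<dots> = B" using A by (simp add: matrix_mul_assoc matrix_inv_inverse)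
  finally show "inverse_in_RH_inf T A"
    using A B by (simp add: inverse_in_RH_inf_def)
qed

section \<open>Block matrices\<close>

lemma four_blocks_nth [simp]:
  "four_blocks A B C D $ Inl i $ Inl j = A $ i $ j"
  "four_blocks A B C D $ Inl i $ Inr l = B $ i $ l"
  "four_blocks A B C D $ Inr k $ Inl j = C $ k $ j"
  "four_blocks A B C D $ Inr k $ Inr l = D $ k $ l"
  by (simp_all add: four_blocks_def row_blocks_def col_blocks_def)

lemma blocks_eq_iff:
  "row_blocks A B = row_blocks A' B' \<longleftrightarrow> A = A' \<and> B = B'"
  "col_blocks C D = col_blocks C' D' \<longleftrightarrow> C = C' \<and> D = D'"
  by (auto simp: vec_eq_iff row_blocks_def col_blocks_def split: sum.splits)

lemma matrix_eq_sum_index: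
  fixes A B :: "'a ^ ('m::finite + 'n::finite) ^ ('r::finite + 's::finite)"
  shows "A = B \<longleftrightarrow> 
    (\<forall>i j. A $ Inl i $ Inl j = B $ Inl i $ Inl j) \<and> (\<forall>i j. A $ Inl i $ Inr j = B $ Inl i $ Inr j) \<and>
    (\<forall>i j. A $ Inr i $ Inl j = B $ Inr i $ Inl j) \<and> (\<forall>i j. A $ Inr i $ Inr j = B $ Inr i $ Inr j)"
  unfolding vec_eq_iff by (metis sum.exhaust)

lemma sum_UNIV_sum_type:
  fixes f :: "'m::finite + 'n::finite \<Rightarrow> 'a::comm_monoid_add"
  shows "sum f UNIV = (\<Sum>i\<in>UNIV. f (Inl i)) + (\<Sum>j\<in>UNIV. f (Inr j))"
  by (subst UNIV_Plus_UNIV[symmetric], subst sum.Plus) simp_all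

lemma row_blocks_mult_four_blocks:
  fixes A :: "'a::semiring_1 ^ 'm::finite ^ 'r::finite" and B :: "'a ^ 'n::finite ^ 'r"
  shows "row_blocks A B ** four_blocks C D E F = row_blocks (A ** C + B ** E) (A ** D + B ** F)"
  by (simp add: vec_eq_iff matrix_matrix_mult_def sum_UNIV_sum_type row_blocks_def four_blocks_def
      col_blocks_def split: sum.splits)

lemma four_blocks_mult_col_blocks:
  fixes A :: "'a::semiring_1 ^ 'm::finite ^ 'r::finite" and D :: "'a ^ 'n::finite ^ 's::finite"
  shows "four_blocks A B C D ** col_blocks E F = col_blocks (A ** E + B ** F) (C ** E + D ** F)"
  by (simp add: vec_eq_iff matrix_matrix_mult_def sum_UNIV_sum_type row_blocks_def four_blocks_def
      col_blocks_def split: sum.splits)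

lemma four_blocks_mult:
  fixes A :: "'a::semiring_1 ^ 'm::finite ^ 'r::finite" and D :: "'a ^ 'n::finite ^ 's::finite"
    and A' :: "'a ^ 'k::finite ^ 'm" and D' :: "'a ^ 'l::finite ^ 'n"
  shows "four_blocks A B C D ** four_blocks A' B' C' D' =
    four_blocks (A ** A' + B ** C') (A ** B' + B ** D') (C ** A' + D ** C') (C ** B' + D ** D')"
  by (simp add: matrix_eq_sum_index) (simp add: matrix_matrix_mult_def sum_UNIV_sum_type)

lemma mat_1_four_blocks:
  "(mat 1 :: 'a::zero_neq_one ^ ('m::finite + 'n::finite) ^ ('m + 'n)) = four_blocks (mat 1) 0 0 (mat 1)"
  by (simp add: matrix_eq_sum_index) (simp add: mat_def)

lemma four_blocks_eq_iff:
  fixes A :: "'a ^ 'm::finite ^ 'r::finite" and D :: "'a ^ 'n::finite ^ 's::finite"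
  shows "four_blocks A B C D = four_blocks A' B' C' D' \<longleftrightarrow> A = A' \<and> B = B' \<and> C = C' \<and> D = D'"
  by (auto simp: four_blocks_def blocks_eq_iff)

lemma four_blocks_cases:
  fixes M :: "'a ^ ('m::finite + 'n::finite) ^ ('r::finite + 's::finite)"
  obtains A B C D where "M = four_blocks A B C D"
proof
  show "M = four_blocks (\<chi> i j. M $ Inl i $ Inl j) (\<chi> i j. M $ Inl i $ Inr j)
      (\<chi> i j. M $ Inr i $ Inl j) (\<chi> i j. M $ Inr i $ Inr j)"
    by (simp add: matrix_eq_sum_index)
qed

lemma four_blocks_in_RH_inf_iff:
  "four_blocks A B C D \<in> RH_inf T \<longleftrightarrow>
     A \<in> RH_inf T \<and> B \<in> RH_inf T \<and> C \<in> RH_inf T \<and> D \<in> RH_inf T"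
proof
  assume M: "four_blocks A B C D \<in> RH_inf T"
  then have "\<And>i j. proper (four_blocks A B C D $ i $ j) \<and>
      poles (four_blocks A B C D $ i $ j) \<subseteq> stability_region T"
    by (simp add: RH_inf_def)
  from this[of "Inl _" "Inl _"] this[of "Inl _" "Inr _"] this[of "Inr _" "Inl _"] this[of "Inr _" "Inr _"]
  show "A \<in> RH_inf T \<and> B \<in> RH_inf T \<and> C \<in> RH_inf T \<and> D \<in> RH_inf T"
    by (simp add: RH_inf_def)
next
  assume "A \<in> RH_inf T \<and> B \<in> RH_inf T \<and> C \<in> RH_inf T \<and> D \<in> RH_inf T"
  then show "four_blocks A B C D \<in> RH_inf T"
    by (auto simp: RH_inf_def four_blocks_def col_blocks_def row_blocks_def split: sum.splits)
qed

section \<open>Robust stability\<close>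

lemma mat_1_minus_closed_loop:
  "mat 1 - closed_loop P K = four_blocks (mat 1) (- P) (- K) (mat 1)"
  by (simp add: closed_loop_def mat_1_four_blocks matrix_eq_sum_index)

lemma matrix_mult_uminus:
  fixes A :: "'a::ring_1 ^ 'n::finite ^ 'm::finite" and B :: "'a ^ 'k::finite ^ 'n"
  shows "(- A) ** B = - (A ** B)" "A ** (- B) = - (A ** B)"
  by (simp_all add: vec_eq_iff matrix_matrix_mult_def sum_negf)

lemma matrix_mult_rdistrib:
  fixes A B :: "'a::ring_1 ^ 'n::finite ^ 'm::finite" and C :: "'a ^ 'k::finite ^ 'n"
  shows "(A + B) ** C = A ** C + B ** C" "(A - B) ** C = A ** C - B ** C"
  by (simp_all add: vec_eq_iff matrix_matrix_mult_def sum.distrib sum_subtractf distrib_right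
      left_diff_distrib)

text \<open>
  For \<open>\<Delta> = 0\<close> the right-hand side is the identity, that is, the nominal response inverts the
  nominal loop.  The perturbation subtracts \<open>\<Delta>\<close> times the second block row of the response
  from the first block row.
\<close>

lemma perturbed_loop_mult_nominal_response:
  fixes G \<Delta> :: "('u::finite, 'y::finite) tf_matrix"
  assumes Y: "Y - G ** U = mat 1" and W: "W = G ** Z" and KY: "K ** Y = U"
    and KW: "Z - K ** W = mat 1"
  shows "(mat 1 - closed_loop (G + \<Delta>) K) ** four_blocks Y W U Z =
    four_blocks (mat 1 - \<Delta> ** U) (- (\<Delta> ** Z)) 0 (mat 1)"
proof -
  have "Y + (- (G + \<Delta>)) ** U = mat 1 - \<Delta> ** U"
    unfolding Y[symmetric] by (simp add: matrix_mult_uminus matrix_mult_rdistrib)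
  moreover have "W + (- (G + \<Delta>)) ** Z = - (\<Delta> ** Z)"
    unfolding W by (simp add: matrix_mult_uminus matrix_mult_rdistrib)
  moreover have "(- K) ** Y + U = 0"
    by (simp add: matrix_mult_uminus KY)
  moreover have "(- K) ** W + Z = mat 1"
    unfolding KW[symmetric] by (simp add: matrix_mult_uminus)
  ultimately show ?thesis
    by (simp only: mat_1_minus_closed_loop four_blocks_mult matrix_mul_lid)
qed

lemma inverse_in_RH_inf_perturbed_loop_iff:
  fixes G \<Delta> :: "('u::finite, 'y::finite) tf_matrix"
  assumes Y: "Y - G ** U = mat 1" and W: "W = G ** Z" and KY: "K ** Y = U"
    and KW: "Z - K ** W = mat 1"
    and stable: "four_blocks Y W U Z \<in> RH_inf T" "\<Delta> \<in> RH_inf T"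
  shows "inverse_in_RH_inf T (mat 1 - closed_loop (G + \<Delta>) K) \<longleftrightarrow>
    inverse_in_RH_inf T (mat 1 - \<Delta> ** U)"
proof
  assume "inverse_in_RH_inf T (mat 1 - closed_loop (G + \<Delta>) K)"
  then obtain N where N: "N \<in> RH_inf T" "(mat 1 - closed_loop (G + \<Delta>) K) ** N = mat 1"
    unfolding inverse_in_RH_inf_iff by blast
  obtain A B C D where ABCD: "N = four_blocks A B C D"
    by (rule four_blocks_cases)
  \<comment> \<open>Cancelling the loop on the left gives \<open>N\<close> times the triangular matrix \<open>=\<close> the nominal
    response; the lower left block of this identity involves only stable matrices.\<close>
  have "N ** ((mat 1 - closed_loop (G + \<Delta>) K) ** four_blocks Y W U Z) = four_blocks Y W U Z"
    using matrix_left_right_inverse1[OF N(2)] by (simp add: matrix_mul_assoc)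
  then have "C ** (mat 1 - \<Delta> ** U) = U"
    by (simp add: perturbed_loop_mult_nominal_response[OF Y W KY KW] ABCD four_blocks_mult
        four_blocks_eq_iff)
  \<comment> \<open>Push-through: \<open>(I + \<Delta> C) (I - \<Delta> U) = I - \<Delta> U + \<Delta> U\<close>.\<close>
  then have "(mat 1 + \<Delta> ** C) ** (mat 1 - \<Delta> ** U) = mat 1"
    by (simp add: matrix_mult_rdistrib flip: matrix_mul_assoc)
  then have "(mat 1 - \<Delta> ** U) ** (mat 1 + \<Delta> ** C) = mat 1"
    by (rule matrix_left_right_inverse1)
  moreover have "mat 1 + \<Delta> ** C \<in> RH_inf T"
    using N(1) stable(2) by (auto simp: ABCD four_blocks_in_RH_inf_iff
        intro!: RH_inf_add RH_inf_mult RH_inf_mat_1)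
  ultimately show "inverse_in_RH_inf T (mat 1 - \<Delta> ** U)"
    unfolding inverse_in_RH_inf_iff by blast
next
  assume "inverse_in_RH_inf T (mat 1 - \<Delta> ** U)"
  then obtain M where M: "M \<in> RH_inf T" "(mat 1 - \<Delta> ** U) ** M = mat 1"
    unfolding inverse_in_RH_inf_iff by blast
  \<comment> \<open>The inverse of the triangular matrix, by back substitution.\<close>
  let ?V = "four_blocks M (M ** (\<Delta> ** Z)) 0 (mat 1)"
  have "four_blocks (mat 1 - \<Delta> ** U) (- (\<Delta> ** Z)) 0 (mat 1) ** ?V = mat 1"
    using M(2) by (simp add: four_blocks_mult mat_1_four_blocks four_blocks_eq_iff matrix_mul_assoc)
  then have "(mat 1 - closed_loop (G + \<Delta>) K) ** (four_blocks Y W U Z ** ?V) = mat 1"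
    unfolding perturbed_loop_mult_nominal_response[OF Y W KY KW, of \<Delta>, symmetric]
    by (simp add: matrix_mul_assoc)
  moreover have "four_blocks Y W U Z ** ?V \<in> RH_inf T"
    using M stable by (auto simp: four_blocks_in_RH_inf_iff RH_inf_0 RH_inf_mat_1 
       intro!: RH_inf_mult)
  ultimately show "inverse_in_RH_inf T (mat 1 - closed_loop (G + \<Delta>) K)"
    unfolding inverse_in_RH_inf_iff by blast
qed

theorem corollary19:
  fixes T :: time_setting
    and G \<Delta> :: "('u::finite, 'y::finite) tf_matrix"
    and Y :: "('y, 'y) tf_matrix"
    and W :: "('u, 'y) tf_matrix"
    and U :: "('y, 'u) tf_matrix"
    and Z :: "('u, 'u) tf_matrix"
  assumes "G \<in> R_sp"
    and "row_blocks (mat 1) (- G) ** four_blocks Y W U Z = row_blocks (mat 1) 0"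
    and "four_blocks Y W U Z ** col_blocks (- G) (mat 1) = col_blocks 0 (mat 1)"
    and "Y \<in> RH_inf T" and "U \<in> RH_inf T" and "W \<in> RH_inf T" and "Z \<in> RH_inf T"
    and "\<Delta> \<in> RH_inf T"
  shows "internally_stabilizes T (U ** matrix_inv Y) (G + \<Delta>) \<longleftrightarrow>
         inverse_in_RH_inf T (mat 1 - \<Delta> ** U)"
proof -
  have Y: "Y - G ** U = mat 1" and W: "W = G ** Z"
    using assms(2) by (simp_all add: row_blocks_mult_four_blocks blocks_eq_iff matrix_mult_uminus)
  have W': "W = Y ** G" and Z: "Z - U ** G = mat 1"
    using assms(3) by (simp_all add: four_blocks_mult_col_blocks blocks_eq_iff matrix_mult_uminus
        algebra_simps)
  have GU: "deg_le (-1) ((G ** U) $ i $ j)" for i j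
    using deg_le_matrix_mult[of "-1" G 0 U] assms(1,5)
    by (simp add: R_sp_def RH_inf_def proper_iff_deg_le strictly_proper_iff_deg_le)
  have Y': "Y = mat 1 + G ** U"
    using Y by (simp add: algebra_simps)
  have inv: "invertible Y" and Yinv: "matrix_inv Y \<in> R_p"
    unfolding Y' using GU by (simp_all add: mat_1_plus_strictly_proper_invertible matrix_inv_proper)
  have "U ** matrix_inv Y \<in> R_p"
    using deg_le_matrix_mult[of 0 U 0 "matrix_inv Y"] Yinv assms(5)
    by (simp add: R_p_def RH_inf_def proper_iff_deg_le)
  moreover have "(U ** matrix_inv Y) ** Y = U"
    using matrix_inv_inverse(2)[OF inv] by (simp flip: matrix_mul_assoc)
  moreover from this have "Z - (U ** matrix_inv Y) ** W = mat 1"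
    using Z by (simp add: W' matrix_mul_assoc)
  ultimately show ?thesis
    using inverse_in_RH_inf_perturbed_loop_iff[OF Y W] assms(4-8)
    by (simp add: internally_stabilizes_def four_blocks_in_RH_inf_iff)
qed

end
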